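(* Let $X$ and $Y$ be quasi-Banach spaces, let $p$ be the exponent ($0<p\le 1$) described in the context, and let $\varphi:X^{2}\to[0,\infty)$ be a function satisfying $$\Phi(x,y):=\sum_{j=1}^{\infty}4^{(j-1)p}\,\varphi\left(\frac{x}{2^{j}},\frac{y}{2^{j}}\right)<\infty$$ for all $x,y\in X$. Let $f:X^{2}\to Y$ be a mapping satisfying $f(x,0)=f(0,z)=0$ and $$\|f(x+y,z+w)+f(x-y,z-w)-2f(x,z)-2f(x,w)\|\le\varphi^{\frac1p}(x,y)\,\varphi^{\frac1p}(z,w)$$ for all $x,y,z,w\in X$. Then there exists a unique additive-quadratic mapping $F:X^{2}\to Y$ such that $$\|f(x,z)-F(x,z)\|\le\min\left\{\Psi^{\frac1p}(x,x)\,\varphi^{\frac1p}(z,0),\ \varphi^{\frac1p}(x,0)\,\Phi^{\frac1p}(z,z)\right\}$$ for all $x,z\in X$, where $$\Psi(x,y):=\sum_{j=1}^{\infty}2^{(j-1)p}\,\varphi\left(\frac{x}{2^{j}},\frac{y}{2^{j}}\right)$$ for all $x,y\in X$.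
   Context: A quasi-norm on a real vector space $X$ is a map $\|\cdot\|:X\to[0,\infty)$ such that $\|x\|=0$ iff $x=0$; $\|ax\|=|a|\|x\|$ for $a\in\mathbb{R}$, $x\in X$; and $\|x+y\|\le C(\|x\|+\|y\|)$ for all $x,y\in X$, with a constant $C\ge1$ independent of $x,y$. A quasi-Banach space is a vector space with a quasi-norm for which it is complete. A quasi-norm is called a $p$-norm if $\|x+y\|^{p}\le\|x\|^{p}+\|y\|^{p}$ for all $x,y$. By the Aoki–Rolewicz theorem, every quasi-norm admits an equivalent $p$-norm for some $0<p\le1$; $p$ denotes such an exponent for the quasi-norm of $Y$. Here $\varphi^{1/p}(x,y)$ means $(\varphi(x,y))^{1/p}$, and similarly for $\Phi$ and $\Psi$. A mapping $F:X^2\to Y$ is called additive-quadratic if $F(x+y,z+w)+F(x-y,z-w)-2F(x,z)-2F(x,w)=0$ for all $x,y,z,w\in X$.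
   Formalization: The quasi-norm of Y is assumed to be itself a p-norm, with 0<p≤1, rather than merely equivalent to one; without this the stated bound, which has no equivalence constant, can fail. *)

theory Defs
  imports Complex_Main
begin

definition quasi_norm :: "('a::real_vector \<Rightarrow> real) \<Rightarrow> bool" where
  "quasi_norm N \<longleftrightarrow>
     (\<forall>x. 0 \<le> N x) \<and>
     (\<forall>x. N x = 0 \<longleftrightarrow> x = 0) \<and>
     (\<forall>a x. N (a *\<^sub>R x) = \<bar>a\<bar> * N x) \<and>
     (\<exists>C\<ge>1. \<forall>x y. N (x + y) \<le> C * (N x + N y))"

definition quasi_banach :: "('a::real_vector \<Rightarrow> real) \<Rightarrow> bool" where
  "quasi_banach N \<longleftrightarrow>
     quasi_norm N \<and>
     (\<forall>u :: nat \<Rightarrow> 'a.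
        (\<forall>e>0. \<exists>K. \<forall>m\<ge>K. \<forall>n\<ge>K. N (u m - u n) < e) \<longrightarrow>
        (\<exists>l. (\<lambda>n. N (u n - l)) \<longlonglongrightarrow> 0))"

definition p_norm :: "real \<Rightarrow> ('a::real_vector \<Rightarrow> real) \<Rightarrow> bool" where
  "p_norm p N \<longleftrightarrow>
     quasi_norm N \<and> (\<forall>x y. N (x + y) powr p \<le> N x powr p + N y powr p)"

definition additive_quadratic ::
    "('a::real_vector \<Rightarrow> 'a \<Rightarrow> 'b::real_vector) \<Rightarrow> bool" where
  "additive_quadratic F \<longleftrightarrow>
     (\<forall>x y z w. F (x + y) (z + w) + F (x - y) (z - w)
                  - 2 *\<^sub>R F x z - 2 *\<^sub>R F x w = 0)"

text \<open>
  The series below start at \<open>j = 1\<close> in the usual notation: with \<open>j = Suc i\<close> the general term is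
  \<open>b powr ((j - 1) * p) * \<phi> (x / 2^j) (y / 2^j)\<close>, where \<open>b\<close> is \<open>4\<close> or \<open>2\<close>.
\<close>

definition scaled_term ::
    "real \<Rightarrow> real \<Rightarrow> ('a::real_vector \<Rightarrow> 'a \<Rightarrow> real) \<Rightarrow> 'a \<Rightarrow> 'a \<Rightarrow> nat \<Rightarrow> real" where
  "scaled_term b p \<phi> x y i =
     b powr (real i * p) * \<phi> (x /\<^sub>R 2 ^ Suc i) (y /\<^sub>R 2 ^ Suc i)"

text \<open>
  The sums are meaningful only if the series converge. For nonnegative \<open>\<phi>\<close> and \<open>p > 0\<close>,
  convergence of the series for \<open>Phi\<close> implies that of the series for \<open>Psi\<close>, by comparison.
\<close>

definition Phi :: "real \<Rightarrow> ('a::real_vector \<Rightarrow> 'a \<Rightarrow> real) \<Rightarrow> 'a \<Rightarrow> 'a \<Rightarrow> real" where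
  "Phi p \<phi> x y = (\<Sum>i. scaled_term 4 p \<phi> x y i)"

definition Psi :: "real \<Rightarrow> ('a::real_vector \<Rightarrow> 'a \<Rightarrow> real) \<Rightarrow> 'a \<Rightarrow> 'a \<Rightarrow> real" where
  "Psi p \<phi> x y = (\<Sum>i. scaled_term 2 p \<phi> x y i)"

end

theory Submission
  imports Defs
begin

text \<open>
  The cases \<open>(y, w) = (x, 0)\<close> and \<open>(y, w) = (0, z)\<close> of the hypothesis, at halved arguments, show that
  \<open>2^n f(x/2^n, z)\<close> and \<open>4^n f(x, z/2^n)\<close> are Cauchy; their limits \<open>F\<^sub>1\<close> and \<open>F\<^sub>2\<close> are
  additive-quadratic and satisfy the first and the second bound, respectively. Either bound forces an
  additive-quadratic \<open>F\<close> to vanish for \<open>x = 0\<close>, because \<open>\<phi>(0, 0) = 0\<close>, so that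
  \<open>F(x, z) = 8^n F(x/2^n, z/2^n)\<close>. As either bound is \<open>o(8^-n)\<close> at \<open>(x/2^n, z/2^n)\<close>,
  \<open>F(x, z)\<close> is the limit of \<open>8^n f(x/2^n, z/2^n)\<close>. This gives
  both \<open>F\<^sub>1 = F\<^sub>2\<close> and uniqueness.
\<close>

subsection \<open>Convergence with respect to a \<open>p\<close>-norm\<close>

locale p_normed =
  fixes N :: "'b::real_vector \<Rightarrow> real" and p :: real
  assumes p_pos: "0 < p" and p_norm: "p_norm p N"
begin

text \<open>The \<open>p\<close>-th power is used because it satisfies the triangle inequality with
  constant 1, so that limits behave as in a metric space.\<close>

definition converges :: "(nat \<Rightarrow> 'b) \<Rightarrow> 'b \<Rightarrow> bool" where
  "converges u l \<longleftrightarrow> (\<lambda>n. N (u n - l) powr p) \<longlonglongrightarrow> 0"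

lemma N_nonneg [simp]: "0 \<le> N v"
  using p_norm by (simp add: p_norm_def quasi_norm_def)

lemma N_eq_0_iff [simp]: "N v = 0 \<longleftrightarrow> v = 0"
  using p_norm by (simp add: p_norm_def quasi_norm_def)

lemma N_scaleR: "N (c *\<^sub>R v) = \<bar>c\<bar> * N v"
  using p_norm by (simp add: p_norm_def quasi_norm_def)

lemma N_powr_scaleR: "N (c *\<^sub>R v) powr p = \<bar>c\<bar> powr p * N v powr p"
  by (simp add: N_scaleR powr_mult)

lemma N_powr_scaleR_power:
  assumes "0 < b"
  shows "N (b ^ n *\<^sub>R v) powr p = b powr (real n * p) * N v powr p"
  using assms by (simp add: N_powr_scaleR powr_powr flip: powr_realpow)

lemma N_powr_triangle: "N (v + w) powr p \<le> N v powr p + N w powr p"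
  using p_norm by (simp add: p_norm_def)

lemma N_minus_commute: "N (v - w) = N (w - v)"
  using N_scaleR[of "-1" "w - v"] by simp

lemma N_powr_diff_triangle: "N (u - w) powr p \<le> N (u - v) powr p + N (v - w) powr p"
  using N_powr_triangle[of "u - v" "v - w"] by simp

text \<open>Raising to the power \<open>p\<close> undoes the exponents \<open>1/p\<close>. This
  moves the hypothesis and the conclusion of the theorem to \<open>p\<close>-th powers, where the
  triangle inequality is available.\<close>

lemma N_le_iff_powr_le:
  assumes "0 \<le> A" "0 \<le> B"
  shows "N v \<le> A powr (1/p) * B powr (1/p) \<longleftrightarrow> N v powr p \<le> A * B"
proof -
  have "A * B = (A powr (1/p) * B powr (1/p)) powr p"
    using assms p_pos by (simp add: powr_mult powr_powr)
  then show ?thesis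
    using p_pos powr_mono2[of p "N v" "A powr (1/p) * B powr (1/p)"]
      powr_less_mono2[of p "A powr (1/p) * B powr (1/p)" "N v"]
    by (auto simp: not_le intro: leI)
qed

lemma converges_bound:
  assumes "\<And>n. N (u n - l) powr p \<le> e n" "e \<longlonglongrightarrow> 0"
  shows "converges u l"
  unfolding converges_def
  by (rule tendsto_sandwich[OF _ _ tendsto_const assms(2)]) (use assms(1) in auto)

lemma converges_add:
  assumes "converges u l" "converges v m"
  shows "converges (\<lambda>n. u n + v n) (l + m)"
proof (rule converges_bound)
  show "N (u n + v n - (l + m)) powr p \<le> N (u n - l) powr p + N (v n - m) powr p" for n
    using N_powr_triangle[of "u n - l" "v n - m"] by (simp add: algebra_simps)
  show "(\<lambda>n. N (u n - l) powr p + N (v n - m) powr p) \<longlonglongrightarrow> 0"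
    using tendsto_add[OF assms[unfolded converges_def]] by simp
qed

lemma converges_scaleR:
  assumes "converges u l"
  shows "converges (\<lambda>n. c *\<^sub>R u n) (c *\<^sub>R l)"
proof -
  have "(\<lambda>n. \<bar>c\<bar> powr p * N (u n - l) powr p) \<longlonglongrightarrow> \<bar>c\<bar> powr p * 0"
    using assms unfolding converges_def by (intro tendsto_intros)
  then show ?thesis
    unfolding converges_def by (simp add: N_powr_scaleR flip: scaleR_diff_right)
qed

lemma converges_diff:
  assumes "converges u l" "converges v m"
  shows "converges (\<lambda>n. u n - v n) (l - m)"
  using converges_add[OF assms(1) converges_scaleR[OF assms(2), of "-1"]] by simp

text \<open>Inserting \<open>u n\<close> between \<open>v\<close> and \<open>l\<close> costs only an
  error that vanishes, so \<open>B\<close> survives the limit without an extra constant.\<close>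

lemma N_powr_limit_le:
  assumes "converges u l" "\<And>n. N (v - u n) powr p \<le> B"
  shows "N (v - l) powr p \<le> B"
proof (rule LIMSEQ_le_const)
  show "(\<lambda>n. B + N (u n - l) powr p) \<longlonglongrightarrow> B"
    using tendsto_add[OF tendsto_const assms(1)[unfolded converges_def], of B] by simp
  have "N (v - l) powr p \<le> B + N (u n - l) powr p" for n
    using N_powr_diff_triangle[of v l "u n"] assms(2)[of n] by linarith
  then show "\<exists>K. \<forall>n\<ge>K. N (v - l) powr p \<le> B + N (u n - l) powr p"
    by blast
qed

lemma converges_unique:
  assumes "converges u l" "converges u m"
  shows "l = m"
proof -
  have "converges (\<lambda>n. 0) (l - m)"
    using converges_diff[OF assms] by simp
  then have "N (0 - (l - m)) powr p \<le> 0"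
    by (rule N_powr_limit_le) simp
  then show ?thesis
    by (simp add: N_minus_commute)
qed

end

section \<open>Scaling behaviour of the control series\<close>

lemma scaled_term_nonneg:
  assumes "\<And>x y. 0 \<le> \<phi> x y"
  shows "0 \<le> scaled_term b p \<phi> x y i"
  using assms by (simp add: scaled_term_def)

lemma summable_scaled_term_mono:
  assumes "0 \<le> p" "0 < a" "a \<le> b" "\<And>x y. 0 \<le> \<phi> x y" "summable (scaled_term b p \<phi> x y)"
  shows "summable (scaled_term a p \<phi> x y)"
proof (rule summable_comparison_test'[OF assms(5)])
  show "norm (scaled_term a p \<phi> x y n) \<le> scaled_term b p \<phi> x y n" for n
    using assms by (auto simp: scaled_term_def intro!: mult_right_mono powr_mono2)
qed

lemma scaled_term_shift:
  assumes "0 < b"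
  shows "b powr (real n * p) * scaled_term b p \<phi> (x /\<^sub>R 2 ^ n) (y /\<^sub>R 2 ^ n) i
    = scaled_term b p \<phi> x y (i + n)"
  using assms
  by (simp add: scaled_term_def power_add ring_distribs powr_add mult_ac)

text \<open>By \<open>scaled_term_shift\<close>, rescaling drops the first \<open>n\<close> terms,
  so these are the tails of one convergent series.\<close>

lemma scaled_suminf_tendsto_0:
  assumes "0 < b" "\<And>x y. summable (scaled_term b p \<phi> x y)"
  shows "(\<lambda>n. b powr (real n * p) * (\<Sum>i. scaled_term b p \<phi> (x /\<^sub>R 2 ^ n) (y /\<^sub>R 2 ^ n) i)) \<longlonglongrightarrow> 0"
proof -
  have "(\<lambda>n. \<Sum>i. scaled_term b p \<phi> x y (i + n)) \<longlonglongrightarrow> 0"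
    using suminf_exist_split[OF _ assms(2)[of x y]] by (simp add: LIMSEQ_iff)
  moreover have "(\<Sum>i. scaled_term b p \<phi> x y (i + n))
      = b powr (real n * p) * (\<Sum>i. scaled_term b p \<phi> (x /\<^sub>R 2 ^ n) (y /\<^sub>R 2 ^ n) i)" for n
    using assms by (simp add: scaled_term_shift flip: suminf_mult)
  ultimately show ?thesis by simp
qed

lemma scaled_tendsto_0:
  assumes "0 < b" "\<And>x y. summable (scaled_term b p \<phi> x y)"
  shows "(\<lambda>n. b powr (real n * p) * \<phi> (x /\<^sub>R 2 ^ n) (y /\<^sub>R 2 ^ n)) \<longlonglongrightarrow> 0"
proof -
  \<comment> \<open>The \<open>n\<close>-th term has weight \<open>b powr (n * p)\<close> but
    \<open>n + 1\<close> halvings; the spare factor \<open>b powr p\<close> accounts for the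
    offset.\<close>
  have eq: "b powr (real (Suc n) * p) * \<phi> (x /\<^sub>R 2 ^ Suc n) (y /\<^sub>R 2 ^ Suc n)
      = b powr p * scaled_term b p \<phi> x y n" for n
    by (simp add: scaled_term_def ring_distribs powr_add mult_ac)
  have "(\<lambda>n. b powr p * scaled_term b p \<phi> x y n) \<longlonglongrightarrow> 0"
    by (intro tendsto_mult_right_zero summable_LIMSEQ_zero assms)
  then show ?thesis
    unfolding eq[symmetric] by (rule LIMSEQ_imp_Suc)
qed

section \<open>Completeness and Hyers limits\<close>

locale complete_p_normed = p_normed +
  assumes quasi_banach: "quasi_banach N"
begin

text \<open>Telescoping in \<open>p\<close>-th powers bounds differences by blocks of the series
  \<open>a\<close>: small blocks give the Cauchy property, and blocks starting at 0 give the
  distance from \<open>u 0\<close> to the limit.\<close>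

lemma converges_of_summable:
  fixes u :: "nat \<Rightarrow> 'a"
  assumes step: "\<And>n. N (u n - u (Suc n)) powr p \<le> a n" and "summable a"
  obtains l where "converges u l" "N (u 0 - l) powr p \<le> suminf a"
proof -
  have a_nonneg: "0 \<le> a n" for n
    using step[of n] powr_ge_zero order_trans by blast
  have telescope: "N (u m - u (m + k)) powr p \<le> sum a {m..<m + k}" for m k
  proof (induction k)
    case (Suc k)
    then show ?case
      using N_powr_diff_triangle[of "u m" "u (m + Suc k)" "u (m + k)"] step[of "m + k"] by simp
  qed (simp add: p_pos)
  have cauchy: "\<exists>K. \<forall>m\<ge>K. \<forall>n\<ge>K. N (u m - u n) < e" if "0 < e" for e
  proof -
    obtain K where K: "\<And>m n. m \<ge> K \<Longrightarrow> norm (sum a {m..<n}) < e powr p"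
      using \<open>summable a\<close> \<open>0 < e\<close> unfolding summable_Cauchy by (metis powr_gt_zero less_irrefl)
    have *: "N (u m - u n) < e" if "K \<le> m" "m \<le> n" for m n
    proof -
      have "N (u m - u n) powr p < e powr p"
        using telescope[of m "n - m"] K[of m n] that by simp
      then show ?thesis
        using \<open>0 < e\<close> p_pos by (meson N_nonneg less_le_not_le not_less powr_mono2 less_imp_le)
    qed
    then show ?thesis
      by (metis N_minus_commute nat_le_linear)
  qed
  then obtain l where "(\<lambda>n. N (u n - l)) \<longlonglongrightarrow> 0"
    using quasi_banach unfolding quasi_banach_def by blast
  then have "(\<lambda>n. N (u n - l) powr p) \<longlonglongrightarrow> 0 powr p"
    using p_pos by (intro tendsto_powr') auto
  then have lim: "converges u l"
    using p_pos by (simp add: converges_def)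
  moreover have "N (u 0 - u n) powr p \<le> suminf a" for n
    using telescope[of 0 n] sum_le_suminf[OF \<open>summable a\<close>, of "{0..<n}"] a_nonneg by force
  then have "N (u 0 - l) powr p \<le> suminf a"
    by (rule N_powr_limit_le[OF lim])
  ultimately show ?thesis
    using that by blast
qed

text \<open>Hyers' direct method in one variable: consecutive iterates differ by the assumed
  estimate at \<open>x /\<^sub>R 2 ^ n\<close>, weighted by \<open>b powr (n * p)\<close>. The other
  variable is frozen, and \<open>K\<close> holds its share of the bound. It is applied with
  \<open>b = 2\<close> and \<open>b = 4\<close>.\<close>

lemma Hyers_limit:
  fixes h :: "'c::real_vector \<Rightarrow> 'a" and x :: 'c
  assumes "0 < b" "\<And>u. N (h u - b *\<^sub>R h (u /\<^sub>R 2)) powr p \<le> \<phi> (u /\<^sub>R 2) (u /\<^sub>R 2) * K"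
    and summable: "summable (scaled_term b p \<phi> x x)"
  shows "\<exists>l. converges (\<lambda>n. b ^ n *\<^sub>R h (x /\<^sub>R 2 ^ n)) l
    \<and> N (h x - l) powr p \<le> (\<Sum>i. scaled_term b p \<phi> x x i) * K"
proof -
  have "N (b ^ n *\<^sub>R h (x /\<^sub>R 2 ^ n) - b ^ Suc n *\<^sub>R h (x /\<^sub>R 2 ^ Suc n)) powr p
      \<le> scaled_term b p \<phi> x x n * K" for n
  proof -
    have "b ^ n *\<^sub>R h (x /\<^sub>R 2 ^ n) - b ^ Suc n *\<^sub>R h (x /\<^sub>R 2 ^ Suc n)
      = b ^ n *\<^sub>R (h (x /\<^sub>R 2 ^ n) - b *\<^sub>R h (x /\<^sub>R 2 ^ n /\<^sub>R 2))"
      by (simp add: scaleR_diff_right mult_ac)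
    then show ?thesis
      using mult_left_mono[OF assms(2)[of "x /\<^sub>R 2 ^ n"], of "b powr (real n * p)"] assms(1)
      by (simp add: N_powr_scaleR_power scaled_term_def mult_ac)
  qed
  from converges_of_summable[OF this summable_mult2[OF summable]]
  obtain l where "converges (\<lambda>n. b ^ n *\<^sub>R h (x /\<^sub>R 2 ^ n)) l"
    "N (h x - l) powr p \<le> (\<Sum>i. scaled_term b p \<phi> x x i * K)"
    by auto
  then show ?thesis
    by (auto simp: suminf_mult2[OF summable])
qed

end

subsection \<open>Additive-quadratic mappings\<close>

text \<open>A separate name lets the same expression be estimated at \<open>f\<close>, at its
  rescalings and at their limits.\<close>

definition aq_defect ::
    "('a::real_vector \<Rightarrow> 'a \<Rightarrow> 'b::real_vector) \<Rightarrow> 'a \<Rightarrow> 'a \<Rightarrow> 'a \<Rightarrow> 'a \<Rightarrow> 'b" where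
  "aq_defect F x y z w = F (x + y) (z + w) + F (x - y) (z - w) - 2 *\<^sub>R F x z - 2 *\<^sub>R F x w"

lemma additive_quadratic_iff: "additive_quadratic F \<longleftrightarrow> (\<forall>x y z w. aq_defect F x y z w = 0)"
  by (simp add: additive_quadratic_def aq_defect_def)

text \<open>The defect is a fixed linear combination of four values, so it commutes with pointwise
  limits.\<close>

lemma (in p_normed) additive_quadratic_limit:
  assumes "\<And>x z. converges (\<lambda>n. g n x z) (F x z)"
    and "\<And>x y z w. converges (\<lambda>n. aq_defect (g n) x y z w) 0"
  shows "additive_quadratic F"
  unfolding additive_quadratic_iff
proof (intro allI)
  fix x y z w
  have "converges (\<lambda>n. aq_defect (g n) x y z w) (aq_defect F x y z w)"
    unfolding aq_defect_def by (intro converges_diff converges_add converges_scaleR assms(1))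
  then show "aq_defect F x y z w = 0"
    using assms(2) converges_unique by blast
qed

text \<open>The hypothesis on \<open>F 0\<close> is needed: every quadratic function of the second argument alone is
  additive-quadratic.\<close>

lemma additive_quadratic_double:
  assumes "additive_quadratic F" "\<And>z. F 0 z = 0"
  shows "F (2 *\<^sub>R x) (2 *\<^sub>R z) = 8 *\<^sub>R F x z"
proof -
  have eq: "F (x + y) (z + w) + F (x - y) (z - w) = 2 *\<^sub>R F x z + 2 *\<^sub>R F x w" for x y z w
    using assms(1) by (simp add: additive_quadratic_def diff_diff_eq)
  have right_0: "F x 0 = 0" for x
  proof -
    have "2 *\<^sub>R F x 0 = 2 *\<^sub>R F x 0 + 2 *\<^sub>R F x 0"
      using eq[of x 0 0 0] by (simp add: scaleR_2)
    then show ?thesis by simp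
  qed
  \<comment> \<open>The factor 8 is 2 from additivity in the first variable times 4 from the
    quadratic behaviour in the second.\<close>
  have "F (2 *\<^sub>R x) (2 *\<^sub>R z) = 2 *\<^sub>R F x (2 *\<^sub>R z)"
    using eq[of x x "2 *\<^sub>R z" 0] by (simp add: scaleR_2 right_0 assms(2))
  also have "F x (2 *\<^sub>R z) = 4 *\<^sub>R F x z"
    using eq[of x 0 z z] by (simp add: right_0 flip: scaleR_2)
  finally show ?thesis by simp
qed

lemma additive_quadratic_scale:
  assumes "additive_quadratic F" "\<And>z. F 0 z = 0"
  shows "8 ^ n *\<^sub>R F (x /\<^sub>R 2 ^ n) (z /\<^sub>R 2 ^ n) = F x z"
proof (induction n)
  case (Suc n)
  have "8 *\<^sub>R F (x /\<^sub>R 2 ^ Suc n) (z /\<^sub>R 2 ^ Suc n) = F (x /\<^sub>R 2 ^ n) (z /\<^sub>R 2 ^ n)"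
    using additive_quadratic_double[OF assms, of "x /\<^sub>R 2 ^ Suc n" "z /\<^sub>R 2 ^ Suc n"] by simp
  with Suc show ?case
    by (metis power_Suc2 scaleR_scaleR)
qed simp

text \<open>The vanishing of \<open>e 0 z\<close> forces \<open>F 0 z = 0\<close>, hence the exact
  scaling by 8. Rescaling the error bound then shows that \<open>f\<close> alone determines
  \<open>F\<close>.\<close>

lemma (in p_normed) additive_quadratic_eq_limit:
  assumes "additive_quadratic F" "\<And>z. f 0 z = 0"
    and bound: "\<And>x z. N (f x z - F x z) powr p \<le> e x z" and "\<And>z. e 0 z = 0"
    and "(\<lambda>n. 8 powr (real n * p) * e (x /\<^sub>R 2 ^ n) (z /\<^sub>R 2 ^ n)) \<longlonglongrightarrow> 0"
  shows "converges (\<lambda>n. 8 ^ n *\<^sub>R f (x /\<^sub>R 2 ^ n) (z /\<^sub>R 2 ^ n)) (F x z)"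
proof (rule converges_bound[OF _ assms(5)])
  have "F 0 z = 0" for z
    using bound[of 0 z] assms(2,4) by (simp add: N_minus_commute[of 0])
  then have scale: "F x z = 8 ^ n *\<^sub>R F (x /\<^sub>R 2 ^ n) (z /\<^sub>R 2 ^ n)" for n
    by (simp add: additive_quadratic_scale[OF assms(1)])
  show "N (8 ^ n *\<^sub>R f (x /\<^sub>R 2 ^ n) (z /\<^sub>R 2 ^ n) - F x z) powr p
      \<le> 8 powr (real n * p) * e (x /\<^sub>R 2 ^ n) (z /\<^sub>R 2 ^ n)" for n
    unfolding scale[of n] scaleR_diff_right[symmetric]
    by (simp add: N_powr_scaleR_power bound)
qed

theorem corollary1:
  fixes normX :: "'a::real_vector \<Rightarrow> real"
    and normY :: "'b::real_vector \<Rightarrow> real"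
    and p :: real
    and \<phi> :: "'a \<Rightarrow> 'a \<Rightarrow> real"
    and f :: "'a \<Rightarrow> 'a \<Rightarrow> 'b"
  assumes "quasi_banach normX"
    and "quasi_banach normY"
    and "0 < p" and "p \<le> 1"
    and "p_norm p normY"
    and "\<And>x y. 0 \<le> \<phi> x y"
    and "\<And>x y. summable (scaled_term 4 p \<phi> x y)"
    and "\<And>x. f x 0 = 0"
    and "\<And>z. f 0 z = 0"
    and "\<And>x y z w.
           normY (f (x + y) (z + w) + f (x - y) (z - w) - 2 *\<^sub>R f x z - 2 *\<^sub>R f x w)
             \<le> \<phi> x y powr (1 / p) * \<phi> z w powr (1 / p)"
  shows "\<exists>!F :: 'a \<Rightarrow> 'a \<Rightarrow> 'b.
           additive_quadratic F \<and>
           (\<forall>x z. normY (f x z - F x z)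
                    \<le> min (Psi p \<phi> x x powr (1 / p) * \<phi> z 0 powr (1 / p))
                          (\<phi> x 0 powr (1 / p) * Phi p \<phi> z z powr (1 / p)))"
proof -
  interpret complete_p_normed normY p
    by unfold_locales (use assms in auto)
  let ?e1 = "\<lambda>x z. Psi p \<phi> x x * \<phi> z 0" and ?e2 = "\<lambda>x z. \<phi> x 0 * Phi p \<phi> z z"
  note \<phi>_nonneg = \<open>\<And>x y. 0 \<le> \<phi> x y\<close>
  note summable4 = \<open>\<And>x y. summable (scaled_term 4 p \<phi> x y)\<close>
  note f_0 [simp] = \<open>\<And>x. f x 0 = 0\<close> \<open>\<And>z. f 0 z = 0\<close>
  have summable2: "summable (scaled_term 2 p \<phi> x y)" for x y
    by (rule summable_scaled_term_mono[of p 2 4]) (use \<open>0 < p\<close> \<phi>_nonneg summable4 in auto)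
  have Psi_nonneg: "0 \<le> Psi p \<phi> x y" and Phi_nonneg: "0 \<le> Phi p \<phi> x y" for x y
    unfolding Psi_def Phi_def
    by (auto intro!: suminf_nonneg summable2 summable4 scaled_term_nonneg \<phi>_nonneg)
  have defect: "normY (aq_defect f x y z w) powr p \<le> \<phi> x y * \<phi> z w" for x y z w
    using assms(10)[of x y z w] unfolding aq_defect_def
    by (simp add: N_le_iff_powr_le \<phi>_nonneg)
  have \<phi>_lim2: "(\<lambda>n. 2 powr (real n * p) * \<phi> (x /\<^sub>R 2 ^ n) (y /\<^sub>R 2 ^ n)) \<longlonglongrightarrow> 0" for x y
    by (rule scaled_tendsto_0) (simp_all add: summable2)
  have \<phi>_lim4: "(\<lambda>n. 4 powr (real n * p) * \<phi> (x /\<^sub>R 2 ^ n) (y /\<^sub>R 2 ^ n)) \<longlonglongrightarrow> 0" for x y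
    by (rule scaled_tendsto_0) (simp_all add: summable4)
  have Psi_lim: "(\<lambda>n. 2 powr (real n * p) * Psi p \<phi> (x /\<^sub>R 2 ^ n) (y /\<^sub>R 2 ^ n)) \<longlonglongrightarrow> 0" for x y
    unfolding Psi_def by (rule scaled_suminf_tendsto_0) (simp_all add: summable2)
  have Phi_lim: "(\<lambda>n. 4 powr (real n * p) * Phi p \<phi> (x /\<^sub>R 2 ^ n) (y /\<^sub>R 2 ^ n)) \<longlonglongrightarrow> 0" for x y
    unfolding Phi_def by (rule scaled_suminf_tendsto_0) (simp_all add: summable4)
  have \<phi>_0: "\<phi> 0 0 = 0"
  proof -
    \<comment> \<open>Halving fixes the origin, so a null sequence stays above the constant
      \<open>\<phi> 0 0\<close>.\<close>
    have "\<phi> 0 0 \<le> 4 powr (real n * p) * \<phi> 0 0" for n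
      using \<open>0 < p\<close> \<phi>_nonneg[of 0 0] ge_one_powr_ge_zero[of 4 "real n * p"]
        mult_right_mono[of 1 "4 powr (real n * p)" "\<phi> 0 0"] by simp
    then have "\<phi> 0 0 \<le> 0"
      by (intro LIMSEQ_le_const[OF \<phi>_lim4[of 0 0]]) auto
    then show ?thesis
      using \<phi>_nonneg[of 0 0] by simp
  qed
  then have Psi_0: "Psi p \<phi> 0 0 = 0"
    by (simp add: Psi_def scaled_term_def)

  \<comment> \<open>Since 8 = 2 * 4, the factor of each bound in \<open>x\<close> absorbs the weight
    2 and the factor in \<open>z\<close> the weight 4; each product of null sequences is
    null.\<close>
  have powr8: "8 powr (real n * p) = 2 powr (real n * p) * 4 powr (real n * p)" for n
    by (simp flip: powr_mult)
  have e1_lim: "(\<lambda>n. 8 powr (real n * p) * ?e1 (x /\<^sub>R 2 ^ n) (z /\<^sub>R 2 ^ n)) \<longlonglongrightarrow> 0" for x z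
    using tendsto_mult[OF Psi_lim[of x x] \<phi>_lim4[of z 0]] unfolding powr8 by (simp add: mult_ac)
  have e2_lim: "(\<lambda>n. 8 powr (real n * p) * ?e2 (x /\<^sub>R 2 ^ n) (z /\<^sub>R 2 ^ n)) \<longlonglongrightarrow> 0" for x z
    using tendsto_mult[OF \<phi>_lim2[of x 0] Phi_lim[of z z]] unfolding powr8 by (simp add: mult_ac)
  have lim_e1: "converges (\<lambda>n. 8 ^ n *\<^sub>R f (x /\<^sub>R 2 ^ n) (z /\<^sub>R 2 ^ n)) (F x z)"
    if "additive_quadratic F" "\<And>x z. normY (f x z - F x z) powr p \<le> ?e1 x z" for F x z
    by (rule additive_quadratic_eq_limit[OF that(1) _ that(2) _ e1_lim]) (simp_all add: Psi_0)
  have lim_e2: "converges (\<lambda>n. 8 ^ n *\<^sub>R f (x /\<^sub>R 2 ^ n) (z /\<^sub>R 2 ^ n)) (F x z)"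
    if "additive_quadratic F" "\<And>x z. normY (f x z - F x z) powr p \<le> ?e2 x z" for F x z
    by (rule additive_quadratic_eq_limit[OF that(1) _ that(2) _ e2_lim]) (simp_all add: \<phi>_0)

  \<comment> \<open>The two limit mappings and their bounds\<close>
  have ex1: "\<exists>l. converges (\<lambda>n. 2 ^ n *\<^sub>R f (x /\<^sub>R 2 ^ n) z) l
      \<and> normY (f x z - l) powr p \<le> ?e1 x z" for x z
    unfolding Psi_def
  proof (rule Hyers_limit[where h = "\<lambda>x. f x z"])
    show "normY (f u z - 2 *\<^sub>R f (u /\<^sub>R 2) z) powr p \<le> \<phi> (u /\<^sub>R 2) (u /\<^sub>R 2) * \<phi> z 0" for u
      \<comment> \<open>Here \<open>f 0 z\<close> and \<open>f (u /\<^sub>R 2) 0\<close> vanish,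
        leaving the additive doubling.\<close>
      using defect[of "u /\<^sub>R 2" "u /\<^sub>R 2" z 0] by (simp add: aq_defect_def flip: scaleR_2)
  qed (simp_all add: summable2)
  \<comment> \<open>One choice carries both properties, so the limit and the bound concern the same
    value.\<close>
  define F1 where "F1 x z = (SOME l. converges (\<lambda>n. 2 ^ n *\<^sub>R f (x /\<^sub>R 2 ^ n) z) l
      \<and> normY (f x z - l) powr p \<le> ?e1 x z)" for x z
  have F1_lim: "converges (\<lambda>n. 2 ^ n *\<^sub>R f (x /\<^sub>R 2 ^ n) z) (F1 x z)" and
    F1_bound: "normY (f x z - F1 x z) powr p \<le> ?e1 x z" for x z
    using someI_ex[OF ex1[of x z]] unfolding F1_def by auto
  have ex2: "\<exists>l. converges (\<lambda>n. 4 ^ n *\<^sub>R f x (z /\<^sub>R 2 ^ n)) l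
      \<and> normY (f x z - l) powr p \<le> Phi p \<phi> z z * \<phi> x 0" for x z
    unfolding Phi_def
  proof (rule Hyers_limit[where h = "\<lambda>z. f x z"])
    show "normY (f x u - 4 *\<^sub>R f x (u /\<^sub>R 2)) powr p \<le> \<phi> (u /\<^sub>R 2) (u /\<^sub>R 2) * \<phi> x 0" for u
      \<comment> \<open>Both subtracted terms equal \<open>2 *\<^sub>R f x (u /\<^sub>R 2)\<close>,
        and \<open>f x 0 = 0\<close>: this is the quadratic doubling.\<close>
      using defect[of x 0 "u /\<^sub>R 2" "u /\<^sub>R 2"]
      by (simp add: aq_defect_def mult.commute diff_diff_eq flip: scaleR_2 scaleR_add_left)
  qed (simp_all add: summable4)
  define F2 where "F2 x z = (SOME l. converges (\<lambda>n. 4 ^ n *\<^sub>R f x (z /\<^sub>R 2 ^ n)) l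
      \<and> normY (f x z - l) powr p \<le> Phi p \<phi> z z * \<phi> x 0)" for x z
  have F2_lim: "converges (\<lambda>n. 4 ^ n *\<^sub>R f x (z /\<^sub>R 2 ^ n)) (F2 x z)" and
    F2_bound: "normY (f x z - F2 x z) powr p \<le> ?e2 x z" for x z
    using someI_ex[OF ex2[of x z]] unfolding F2_def by (auto simp: mult.commute)

  \<comment> \<open>The functional equation, coincidence and uniqueness\<close>
  have F1_aq: "additive_quadratic F1"
  proof (rule additive_quadratic_limit[OF F1_lim])
    fix x y z w
    show "converges (\<lambda>n. aq_defect (\<lambda>x z. 2 ^ n *\<^sub>R f (x /\<^sub>R 2 ^ n) z) x y z w) 0"
    proof (rule converges_bound)
      fix n
      \<comment> \<open>Only \<open>x\<close> and \<open>y\<close> are halved, so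
        \<open>\<phi> z w\<close> stays a constant factor while the other factor beats the weight 2.
        For \<open>F2\<close> the two pairs exchange roles, with weight 4.\<close>
      have "aq_defect (\<lambda>x z. 2 ^ n *\<^sub>R f (x /\<^sub>R 2 ^ n) z) x y z w
          = 2 ^ n *\<^sub>R aq_defect f (x /\<^sub>R 2 ^ n) (y /\<^sub>R 2 ^ n) z w"
        by (simp add: aq_defect_def algebra_simps)
      then show "normY (aq_defect (\<lambda>x z. 2 ^ n *\<^sub>R f (x /\<^sub>R 2 ^ n) z) x y z w - 0) powr p
          \<le> 2 powr (real n * p) * \<phi> (x /\<^sub>R 2 ^ n) (y /\<^sub>R 2 ^ n) * \<phi> z w"
        using defect by (simp add: N_powr_scaleR_power mult.assoc)
    qed (use tendsto_mult_left_zero[OF \<phi>_lim2] in blast)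
  qed
  have F2_aq: "additive_quadratic F2"
  proof (rule additive_quadratic_limit[OF F2_lim])
    fix x y z w
    show "converges (\<lambda>n. aq_defect (\<lambda>x z. 4 ^ n *\<^sub>R f x (z /\<^sub>R 2 ^ n)) x y z w) 0"
    proof (rule converges_bound)
      fix n
      have "aq_defect (\<lambda>x z. 4 ^ n *\<^sub>R f x (z /\<^sub>R 2 ^ n)) x y z w
          = 4 ^ n *\<^sub>R aq_defect f x y (z /\<^sub>R 2 ^ n) (w /\<^sub>R 2 ^ n)"
        by (simp add: aq_defect_def algebra_simps)
      then show "normY (aq_defect (\<lambda>x z. 4 ^ n *\<^sub>R f x (z /\<^sub>R 2 ^ n)) x y z w - 0) powr p
          \<le> 4 powr (real n * p) * \<phi> (z /\<^sub>R 2 ^ n) (w /\<^sub>R 2 ^ n) * \<phi> x y"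
        using defect[of x y "z /\<^sub>R 2 ^ n" "w /\<^sub>R 2 ^ n"]
        by (simp add: N_powr_scaleR_power mult.assoc mult.commute[of _ "\<phi> x y"])
    qed (use tendsto_mult_left_zero[OF \<phi>_lim4] in blast)
  qed
  \<comment> \<open>The bound for \<open>F1\<close> and the bound for \<open>F2\<close> each
    identify the mapping with the limit of the same sequence of rescalings of
    \<open>f\<close>.\<close>
  have "F1 = F2"
    using converges_unique[OF lim_e1[OF F1_aq F1_bound] lim_e2[OF F2_aq F2_bound]] by blast

  have bound_iff: "normY v \<le> min (Psi p \<phi> x x powr (1 / p) * \<phi> z 0 powr (1 / p))
      (\<phi> x 0 powr (1 / p) * Phi p \<phi> z z powr (1 / p))
      \<longleftrightarrow> normY v powr p \<le> ?e1 x z \<and> normY v powr p \<le> ?e2 x z" for v x z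
    by (simp add: N_le_iff_powr_le \<phi>_nonneg Psi_nonneg Phi_nonneg)
  show ?thesis
    unfolding bound_iff
  proof (rule ex1I[of _ F1])
    show "additive_quadratic F1 \<and>
        (\<forall>x z. normY (f x z - F1 x z) powr p \<le> ?e1 x z \<and> normY (f x z - F1 x z) powr p \<le> ?e2 x z)"
      using F1_aq F1_bound F2_bound \<open>F1 = F2\<close> by blast
  next
    fix G
    assume "additive_quadratic G \<and>
        (\<forall>x z. normY (f x z - G x z) powr p \<le> ?e1 x z \<and> normY (f x z - G x z) powr p \<le> ?e2 x z)"
    then have G: "additive_quadratic G" "\<And>x z. normY (f x z - G x z) powr p \<le> ?e1 x z"
      by auto
    show "G = F1"
      using converges_unique[OF lim_e1[OF G] lim_e1[OF F1_aq F1_bound]] by blast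
  qed
qed

end
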